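(* For a positive integer $n$ let $f_n : \mathbb{R} \to \mathbb{R}$ be given by $f_n(x) = \sum_{k=1}^{n} \frac{|\sin(k\pi x)|}{k}$. Then the following two statements hold. (i) For every $\varepsilon > 0$ there exists $q_0$ such that for all integers $q \geq q_0$, all integers $p$ with $\gcd(p,q)=1$, and all integers $n \geq (1+\varepsilon)\, q^2/\pi$, the function $f_n$ has a strict local minimum at $x = p/q$. (ii) The constant $1/\pi$ is optimal: for every real $c$ with $0 < c < 1/\pi$ there exists $q_1$ such that for every integer $q \geq q_1$ there are an integer $p$ with $\gcd(p,q)=1$ and an integer $n \geq c\, q^2$ such that $f_n$ does not have a strict local minimum at $x = p/q$.
   Context: A function $f:\mathbb{R}\to\mathbb{R}$ has a strict local minimum at $x_0$ if there is $\delta>0$ such that $f(x) > f(x_0)$ for all $x$ with $0<|x-x_0|<\delta$. *)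

theory Defs
  imports "HOL-Analysis.Analysis"
begin

definition strict_local_min_at :: "(real \<Rightarrow> real) \<Rightarrow> real \<Rightarrow> bool" where
  "strict_local_min_at f x0 \<longleftrightarrow>
     (\<exists>\<delta>>0. \<forall>x. 0 < \<bar>x - x0\<bar> \<and> \<bar>x - x0\<bar> < \<delta> \<longrightarrow> f x > f x0)"

definition abs_sin_sum :: "nat \<Rightarrow> real \<Rightarrow> real" where
  "abs_sin_sum n x = (\<Sum>k=1..n. \<bar>sin (real k * pi * x)\<bar> / real k)"

end

theory Submission
  imports Defs
begin

(* At p/q the summands with q | k have a kink of slope \<plusminus>pi and all others are differentiable, so
   the one-sided derivatives of f_n at p/q are pi (D \<plusminus> N) with N = n div q and
   D = sum_{k <= n} sgn (sin (k pi p/q)) cos (k pi p/q). Hence there is a strict local minimum if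
   |D| < N, and none if |D| > N. The summands of D are q-periodic in k and cancel over a full
   period, so only n mod q of them remain; these are values cos (pi r/q) at distinct residues
   r in {1..q-1}. Their sum is therefore at most the sum of all positive values cos (pi r/q), which
   is at most q/pi by comparison with the integral of cos, whereas N is about n/q. The bound is
   attained up to O(1) for p = 1 and n mod q = q div 2. *)

section \<open>One-sided derivatives of the sum\<close>

text \<open>At a zero of \<open>g\<close>, the right difference quotient of |g| is the absolute
  value of that of \<open>g\<close>, because x - a > 0. At any other point the sign of
  \<open>g\<close> is constant nearby, so |g| is locally a constant multiple of
  \<open>g\<close>.\<close>

lemma has_real_derivative_abs_at_right:
  fixes g :: "real \<Rightarrow> real"
  assumes "(g has_real_derivative d) (at_right a)"
  shows "((\<lambda>x. \<bar>g x\<bar>) has_real_derivative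
           (if g a = 0 then \<bar>d\<bar> else sgn (g a) * d)) (at_right a)"
proof (cases "g a = 0")
  case True
  have "((\<lambda>x. \<bar>(g x - g a) / (x - a)\<bar>) \<longlongrightarrow> \<bar>d\<bar>) (at_right a)"
    using assms by (intro tendsto_rabs) (simp add: has_field_derivative_iff)
  moreover have "eventually (\<lambda>x. \<bar>(g x - g a) / (x - a)\<bar> = (\<bar>g x\<bar> - \<bar>g a\<bar>) / (x - a)) (at_right a)"
    using True by (auto simp: eventually_at_filter)
  ultimately show ?thesis
    using True by (auto simp: has_field_derivative_iff elim: Lim_transform_eventually)
next
  case False
  have "(g \<longlongrightarrow> g a) (at_right a)"
    using DERIV_continuous[OF assms] by (simp add: continuous_within)
  moreover have "open {y. sgn y = sgn (g a)}"
  proof -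
    have "{y. sgn y = sgn (g a)} = (if g a > 0 then {0<..} else {..<0})"
      using False by (auto simp: sgn_real_def)
    then show ?thesis by auto
  qed
  ultimately have "eventually (\<lambda>x. g x \<in> {y. sgn y = sgn (g a)}) (at_right a)"
    by (intro topological_tendstoD) auto
  then have ev: "eventually (\<lambda>x. sgn (g a) * g x = \<bar>g x\<bar>) (at_right a)"
    by eventually_elim (simp add: abs_sgn mult.commute)
  have "((\<lambda>x. sgn (g a) * g x) has_real_derivative sgn (g a) * d) (at_right a)"
    using assms by (rule DERIV_cmult)
  then have "((\<lambda>x. \<bar>g x\<bar>) has_real_derivative sgn (g a) * d) (at_right a)"
    unfolding has_field_derivative_iff
    by (rule Lim_transform_eventually)
       (use ev in eventually_elim, simp add: abs_sgn mult.commute)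
  with False show ?thesis by simp
qed

text \<open>The derivative of |sin| away from its zeros. Since sgn 0 = 0, it vanishes at the kinks,
  whose contribution can thus be counted separately.\<close>

definition slope :: "real \<Rightarrow> real" where
  "slope x = sgn (sin x) * cos x"

lemma slope_minus: "slope (- x) = - slope x"
  by (simp add: slope_def sgn_minus)

text \<open>A shift by a multiple of pi multiplies sin and cos by the same sign, which cancels in
  the product.\<close>

lemma slope_add_int_pi: "slope (x + of_int i * pi) = slope x"
proof -
  have s: "sin (of_int i * pi) = 0"
    using sin_zero_iff_int2 by blast
  then have "(cos (of_int i * pi))\<^sup>2 = 1"
    using sin_cos_squared_add[of "of_int i * pi"] by simp
  then have "cos (of_int i * pi) = 1 \<or> cos (of_int i * pi) = - 1"
    by (simp add: power2_eq_1_iff)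
  with s show ?thesis
    by (auto simp: slope_def sin_add cos_add sgn_minus)
qed

text \<open>Both one-sided derivatives at once: take \<open>s = 1\<close> and \<open>s = -1\<close>.\<close>

lemma abs_sin_sum_directional_derivative:
  fixes s :: real
  assumes "\<bar>s\<bar> = 1"
  shows "((\<lambda>h. abs_sin_sum n (x + s * h)) has_real_derivative
           pi * (\<Sum>k=1..n. s * slope (real k * pi * x) + of_bool (sin (real k * pi * x) = 0)))
         (at_right 0)"
proof -
  have "((\<lambda>h. \<bar>sin (real k * pi * (x + s * h))\<bar> / real k) has_real_derivative
          pi * (s * slope (real k * pi * x) + of_bool (sin (real k * pi * x) = 0))) (at_right 0)"
    if k: "k \<in> {1..n}" for k
  proof -
    define y where "y = real k * pi * x"
    have "((\<lambda>h. sin (real k * pi * (x + s * h))) has_real_derivative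
            cos y * (real k * pi * s)) (at_right 0)"
      unfolding y_def by (auto intro!: derivative_eq_intros)
    from DERIV_cdivide[OF has_real_derivative_abs_at_right[OF this], of "real k"]
    have "((\<lambda>h. \<bar>sin (real k * pi * (x + s * h))\<bar> / real k) has_real_derivative
            (if sin y = 0 then \<bar>cos y * (real k * pi * s)\<bar>
             else sgn (sin y) * (cos y * (real k * pi * s))) / real k) (at_right 0)"
      unfolding y_def mult_zero_right add_0_right .
    \<comment> \<open>The inner derivative's factor k cancels the weight 1/k. At a zero of the sine
      |cos y| = 1, so a kink contributes exactly pi for either sign of \<open>s\<close>.\<close>
    moreover have "(if sin y = 0 then \<bar>cos y * (real k * pi * s)\<bar>
             else sgn (sin y) * (cos y * (real k * pi * s))) / real k
           = pi * (s * slope y + of_bool (sin y = 0))"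
      using k assms sin_zero_abs_cos_one[of y]
      by (auto simp: slope_def abs_mult)
    ultimately show ?thesis
      by (simp add: y_def)
  qed
  then show ?thesis
    unfolding abs_sin_sum_def sum_distrib_left by (intro DERIV_sum)
qed

section \<open>Counting kinks and reduction modulo q\<close>

lemma sin_multiple_eq_0_iff:
  assumes "q > 0" "coprime p (int q)"
  shows "sin (real k * pi * (of_int p / real q)) = 0 \<longleftrightarrow> q dvd k"
proof -
  have "sin (real k * pi * (of_int p / real q)) = 0 \<longleftrightarrow>
          (\<exists>i::int. real k * pi * (of_int p / real q) = of_int i * pi)"
    by (rule sin_zero_iff_int2)
  also have "\<dots> \<longleftrightarrow> (\<exists>i::int. of_int (int k * p) = (of_int (i * int q) :: real))"
    using assms by (simp add: field_simps)
  also have "\<dots> \<longleftrightarrow> int q dvd int k * p"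
    unfolding of_int_eq_iff by (auto simp: dvd_def mult.commute)
  also have "\<dots> \<longleftrightarrow> q dvd k"
    using assms by (simp add: coprime_dvd_mult_left_iff coprime_commute)
  finally show ?thesis .
qed

lemma sum_of_bool_dvd: "q > 0 \<Longrightarrow> (\<Sum>k=1..n. of_bool (q dvd k)) = real (n div q)"
proof (induction n)
  case (Suc n)
  have "(\<Sum>k=1..Suc n. of_bool (q dvd k)) = (\<Sum>k=1..n. of_bool (q dvd k)) + (of_bool (q dvd Suc n) :: real)"
    unfolding sum.cl_ivl_Suc by simp
  also have "\<dots> = real (n div q) + of_bool (q dvd Suc n)"
    unfolding Suc.IH[OF Suc.prems] ..
  also have "\<dots> = real (Suc n div q)"
    using Suc.prems by (simp add: div_Suc dvd_eq_mod_eq_0)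
  finally show ?case .
qed simp

text \<open>The reflection k -> q - k negates the summands, so the sum over a full period vanishes
  and whole periods can be removed.\<close>

lemma sum_atMost_mod:
  fixes f :: "nat \<Rightarrow> real"
  assumes per: "\<And>k. f (k + q) = f k" and odd: "\<And>k. k \<le> q \<Longrightarrow> f (q - k) = - f k"
  shows "(\<Sum>k\<le>n. f k) = (\<Sum>k\<le>n mod q. f k)"
proof -
  have "(\<Sum>k\<le>q. f k) = (\<Sum>k\<le>q. f (q - k))"
    by (rule sum.reindex_bij_witness[of _ "\<lambda>k. q - k" "\<lambda>k. q - k"]) auto
  also have "\<dots> = - (\<Sum>k\<le>q. f k)"
    by (simp add: odd sum_negf)
  finally have "(\<Sum>k\<le>q. f k) = 0" by simp
  \<comment> \<open>The value f q equals f 0 by periodicity and - f 0 by reflection. This settles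
    the base case m = 0 of \<open>step\<close>, where the range 0..q contains both endpoints of the
    period.\<close>
  moreover have "f 0 = 0"
    using odd[of 0] per[of 0] by simp
  ultimately have step: "(\<Sum>k\<le>m + q. f k) = (\<Sum>k\<le>m. f k)" for m
    by (induction m) (use per[of "Suc _"] in auto)
  have "(\<Sum>k\<le>m + a * q. f k) = (\<Sum>k\<le>m. f k)" for m a
  proof (induction a)
    case (Suc a)
    then show ?case
      using step[of "m + a * q"] by (simp add: algebra_simps)
  qed simp
  from this[of "n mod q" "n div q"] show ?thesis
    by simp
qed

lemma sum_slope_mod:
  assumes "q > 0"
  shows "(\<Sum>k=1..n. slope (real k * pi * (of_int p / real q)))
       = (\<Sum>k=1..n mod q. slope (real k * pi * (of_int p / real q)))"
proof -
  define f where "f k = slope (real k * pi * (of_int p / real q))" for k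
  have "f (k + q) = f k" for k
    using slope_add_int_pi[of "real k * pi * (of_int p / real q)" p] assms
    by (simp add: f_def field_simps)
  moreover have "f (q - k) = - f k" if "k \<le> q" for k
  proof -
    \<comment> \<open>The reflected angle is the negated angle up to a multiple of pi, and
      \<open>slope\<close> is odd and pi-periodic.\<close>
    have "real (q - k) * pi * (of_int p / real q)
        = - (real k * pi * (of_int p / real q)) + of_int p * pi"
      using assms that by (simp add: field_simps)
    then show ?thesis
      by (simp only: f_def slope_add_int_pi slope_minus)
  qed
  ultimately have "(\<Sum>k\<le>n. f k) = (\<Sum>k\<le>n mod q. f k)"
    by (rule sum_atMost_mod)
  moreover have "(\<Sum>k\<le>m. f k) = (\<Sum>k=1..m. f k)" for m
    by (simp add: atMost_atLeast0 sum.atLeast_Suc_atMost f_def slope_def)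
  ultimately show ?thesis
    by (simp add: f_def)
qed

section \<open>Cosine sums compared with the integral of cos\<close>

text \<open>Mean value theorem, with cos decreasing on [0, pi]. This is the comparison of the
  integral of cos with its endpoint values on one grid cell.\<close>

lemma sin_diff_bounds:
  fixes a b :: real
  assumes "0 \<le> a" "a \<le> b" "b \<le> pi"
  shows "(b - a) * cos b \<le> sin b - sin a" "sin b - sin a \<le> (b - a) * cos a"
proof -
  have "\<exists>z. a \<le> z \<and> z \<le> b \<and> sin b - sin a = (b - a) * cos z"
  proof (cases "a = b")
    case False
    then have "a < b" using assms by simp
    from MVT2[OF this, of sin cos, OF DERIV_sin] show ?thesis
      by (auto intro: less_imp_le)
  qed auto
  then obtain z where "a \<le> z" "z \<le> b" "sin b - sin a = (b - a) * cos z"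
    by blast
  with assms show "(b - a) * cos b \<le> sin b - sin a" "sin b - sin a \<le> (b - a) * cos a"
    by (auto intro!: mult_left_mono cos_monotone_0_pi_le)
qed

text \<open>A Riemann sum of a decreasing function at right endpoints stays below the integral from
  0 to m t; the cell bounds telescope.\<close>

lemma sum_cos_le:
  assumes "0 \<le> t" "real m * t \<le> pi"
  shows "t * (\<Sum>r=1..m. cos (real r * t)) \<le> sin (real m * t)"
  using assms
proof (induction m)
  case (Suc m)
  have "t * cos (real (Suc m) * t) \<le> sin (real (Suc m) * t) - sin (real m * t)"
    using sin_diff_bounds(1)[of "real m * t" "real (Suc m) * t"] Suc.prems
    by (simp add: algebra_simps)
  with Suc show ?case
    by (simp add: algebra_simps)
qed simp

text \<open>The same sum read at left endpoints dominates the integral from t to (m + 1) t, hence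
  the shifted limits.\<close>

lemma sum_cos_ge:
  assumes "0 \<le> t" "real (Suc m) * t \<le> pi"
  shows "sin (real (Suc m) * t) - sin t \<le> t * (\<Sum>r=1..m. cos (real r * t))"
  using assms
proof (induction m)
  case (Suc m)
  have "sin (real (Suc (Suc m)) * t) - sin (real (Suc m) * t) \<le> t * cos (real (Suc m) * t)"
    using sin_diff_bounds(2)[of "real (Suc m) * t" "real (Suc (Suc m)) * t"] Suc.prems
    by (simp add: algebra_simps)
  with Suc show ?case
    by (simp add: algebra_simps)
qed simp

lemma slope_eq_cos: "0 < x \<Longrightarrow> x < pi \<Longrightarrow> slope x = cos x"
  by (simp add: slope_def sin_gt_zero)

section \<open>Bounding the slope sum at p/q\<close>

lemma sum_slope_le:
  assumes "coprime p (int q)" "m < q"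
  shows "(\<Sum>k=1..m. slope (real k * pi * (of_int p / real q))) \<le> real q / pi"
proof -
  define t where "t = pi / real q"
  \<comment> \<open>Multiplication by \<open>p\<close> is injective on residues modulo
    \<open>q\<close>; since m < q, the residues \<open>r k\<close> with k in 1..m are nonzero and
    distinct.\<close>
  define r where "r k = nat ((int k * p) mod int q)" for k
  have q: "q > 0" and t: "t > 0" "real q * t = pi"
    using assms by (auto simp: t_def)
  have r_less: "r k < q" for k
    using q by (simp add: r_def nat_less_iff)
  have r_pos: "r k > 0" if "k \<in> {1..m}" for k
  proof -
    have "\<not> int q dvd int k"
      using that assms by (auto dest: dvd_imp_le)
    then have "\<not> int q dvd int k * p"
      using assms by (simp add: coprime_dvd_mult_left_iff coprime_commute)
    then have "(int k * p) mod int q \<noteq> 0"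
      by (simp add: dvd_eq_mod_eq_0)
    moreover have "(int k * p) mod int q \<ge> 0"
      using q by simp
    ultimately show ?thesis
      by (simp add: r_def)
  qed
  have inj: "inj_on r {1..m}"
  proof
    fix j k assume jk: "j \<in> {1..m}" "k \<in> {1..m}" "r j = r k"
    then have "(int j * p) mod int q = (int k * p) mod int q"
      using q by (simp add: r_def eq_nat_nat_iff)
    then have "int q dvd (int j - int k) * p"
      by (simp add: mod_eq_dvd_iff left_diff_distrib)
    then have "int q dvd int j - int k"
      using assms by (simp add: coprime_dvd_mult_left_iff coprime_commute)
    moreover have "\<bar>int j - int k\<bar> < int q"
      using jk assms by auto
    ultimately show "j = k"
      using zdvd_not_zless[of "\<bar>int j - int k\<bar>" "int q"] by auto
  qed
  have slope_r: "slope (real k * pi * (of_int p / real q)) = cos (real (r k) * t)"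
    if "k \<in> {1..m}" for k
  proof -
    \<comment> \<open>Dropping the quotient shifts the angle by a multiple of pi. The remaining
      angle lies strictly between 0 and pi, where \<open>slope\<close> is cos.\<close>
    have "int k * p = int (r k) + (int k * p) div int q * int q"
      using q by (simp add: r_def)
    then have "real k * of_int p = real (r k) + of_int ((int k * p) div int q) * real q"
      by (metis of_int_add of_int_mult of_int_of_nat_eq)
    moreover have "real k * pi * (of_int p / real q) = (real k * of_int p) * t"
      by (simp add: t_def)
    ultimately have "real k * pi * (of_int p / real q)
                   = real (r k) * t + of_int ((int k * p) div int q) * pi"
      using t(2) by (simp add: algebra_simps)
    then have "slope (real k * pi * (of_int p / real q)) = slope (real (r k) * t)"
      by (simp only: slope_add_int_pi)
    also have "\<dots> = cos (real (r k) * t)"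
    proof (rule slope_eq_cos)
      show "0 < real (r k) * t"
        using r_pos[OF that] t by simp
      have "real (r k) * t < real q * t"
        using r_less t by (intro mult_strict_right_mono) auto
      then show "real (r k) * t < pi"
        using t by simp
    qed
    finally show ?thesis .
  qed
  have "(\<Sum>k=1..m. slope (real k * pi * (of_int p / real q))) = (\<Sum>i\<in>r ` {1..m}. cos (real i * t))"
    unfolding sum.reindex[OF inj] comp_def by (rule sum.cong[OF refl slope_r])
  \<comment> \<open>Residues above q/2 give nonpositive cosines and may be dropped; the missing
    residues up to q/2 give nonnegative ones and may be added.\<close>
  also have "\<dots> \<le> (\<Sum>i=1..q div 2. cos (real i * t))"
  proof -
    have neg: "cos (real i * t) \<le> 0" if "i \<in> r ` {1..m} - {1..q div 2}" for i
    proof -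
      from that have "i < q" "q < 2 * i"
        using r_less r_pos by force+
      then have "real q \<le> 2 * real i" "real i \<le> real q"
        by linarith+
      then have "real q * t \<le> 2 * real i * t" "real i * t \<le> real q * t"
        using t by (meson mult_right_mono less_imp_le)+
      with t show ?thesis
        using cos_monotone_0_pi_le[of "pi / 2" "real i * t"] by simp
    qed
    have pos: "cos (real i * t) \<ge> 0" if "i \<in> {1..q div 2}" for i
    proof (rule cos_ge_zero)
      have "real (2 * i) * t \<le> real q * t"
        using that t by (intro mult_right_mono) auto
      with t show "real i * t \<le> pi / 2"
        by simp
      show "- (pi / 2) \<le> real i * t"
        using t by (simp add: order_trans[of "- (pi / 2)" 0])
    qed
    have "(\<Sum>i\<in>r ` {1..m}. cos (real i * t))
        = (\<Sum>i\<in>r ` {1..m} \<inter> {1..q div 2}. cos (real i * t))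
          + (\<Sum>i\<in>r ` {1..m} - {1..q div 2}. cos (real i * t))"
      by (rule sum.Int_Diff) simp
    also have "\<dots> \<le> (\<Sum>i\<in>r ` {1..m} \<inter> {1..q div 2}. cos (real i * t))"
      unfolding add_le_same_cancel1 by (rule sum_nonpos[OF neg])
    also have "\<dots> \<le> (\<Sum>i=1..q div 2. cos (real i * t))"
      using pos by (intro sum_mono2) auto
    finally show ?thesis .
  qed
  also have "\<dots> \<le> real q / pi"
  proof -
    \<comment> \<open>The Riemann sum is at most a sine, hence at most 1; division by t = pi/q
      yields the bound.\<close>
    have "real (q div 2) * t \<le> real q * t"
      using t by (intro mult_right_mono) auto
    then have "t * (\<Sum>i=1..q div 2. cos (real i * t)) \<le> 1"
      using sum_cos_le[of t "q div 2"] sin_le_one[of "real (q div 2) * t"] t by linarith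
    then show ?thesis
      using q by (simp add: t_def field_simps)
  qed
  finally show ?thesis .
qed

text \<open>Replacing \<open>p\<close> by \<open>-p\<close> negates the sum, so the upper bound for
  all numerators also gives the lower bound.\<close>

lemma abs_sum_slope_le:
  assumes "coprime p (int q)" "q > 0"
  shows "\<bar>\<Sum>k=1..n. slope (real k * pi * (of_int p / real q))\<bar> \<le> real q / pi"
proof -
  define S where "S p = (\<Sum>k=1..n. slope (real k * pi * (of_int p / real q)))" for p :: int
  have le: "S p \<le> real q / pi" if "coprime p (int q)" for p
    unfolding S_def sum_slope_mod[OF assms(2), where n = n]
    using that assms(2) by (intro sum_slope_le) auto
  have "S (- p) = - S p"
    by (simp add: S_def slope_minus sum_negf)
  with le[of p] le[of "- p"] assms(1) show ?thesis
    by (simp add: S_def)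
qed

section \<open>Local minima from one-sided derivatives\<close>

lemma abs_sin_sum_derivative_at_fraction:
  fixes s :: real
  assumes "\<bar>s\<bar> = 1" "q > 0" "coprime p (int q)"
  shows "((\<lambda>h. abs_sin_sum n (of_int p / real q + s * h)) has_real_derivative
           pi * (s * (\<Sum>k=1..n. slope (real k * pi * (of_int p / real q))) + real (n div q)))
         (at_right 0)"
  using abs_sin_sum_directional_derivative[OF assms(1), of n "of_int p / real q"]
  unfolding sum.distrib sin_multiple_eq_0_iff[OF assms(2,3)] sum_of_bool_dvd[OF assms(2)]
    sum_distrib_left[symmetric] .

lemma strict_local_min_atI:
  fixes f :: "real \<Rightarrow> real"
  assumes "\<And>s. \<bar>s\<bar> = 1 \<Longrightarrow> \<exists>l>0. ((\<lambda>h. f (x + s * h)) has_real_derivative l) (at_right 0)"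
  shows "strict_local_min_at f x"
proof -
  have ex: "\<exists>d>0. \<forall>h. 0 < h \<and> h < d \<longrightarrow> f x < f (x + s * h)" if s: "\<bar>s\<bar> = 1" for s
  proof -
    from assms[OF s] obtain l where
      "l > 0" "((\<lambda>h. f (x + s * h)) has_real_derivative l) (at_right 0)" by blast
    from has_real_derivative_pos_inc_right[OF this(2,1)] show ?thesis
      by auto
  qed
  from ex[of 1] obtain d where d: "d > 0" "\<And>h. 0 < h \<Longrightarrow> h < d \<Longrightarrow> f x < f (x + h)"
    by auto
  from ex[of "-1"] obtain e where e: "e > 0" "\<And>h. 0 < h \<Longrightarrow> h < e \<Longrightarrow> f x < f (x - h)"
    by auto
  have "f x < f y" if "0 < \<bar>y - x\<bar>" "\<bar>y - x\<bar> < min d e" for y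
    using d(2)[of "y - x"] e(2)[of "x - y"] that by (cases "x < y") auto
  with d(1) e(1) show ?thesis
    unfolding strict_local_min_at_def by (intro exI[of _ "min d e"]) auto
qed

lemma not_strict_local_min_atI:
  fixes f :: "real \<Rightarrow> real"
  assumes "\<bar>s\<bar> = 1" "l < 0" "((\<lambda>h. f (x + s * h)) has_real_derivative l) (at_right 0)"
  shows "\<not> strict_local_min_at f x"
proof
  assume "strict_local_min_at f x"
  then obtain d where d: "d > 0" "\<And>y. 0 < \<bar>y - x\<bar> \<Longrightarrow> \<bar>y - x\<bar> < d \<Longrightarrow> f x < f y"
    unfolding strict_local_min_at_def by blast
  from has_real_derivative_neg_dec_right[OF assms(3,2)] obtain e where
    e: "e > 0" "\<And>h. 0 < h \<Longrightarrow> h < e \<Longrightarrow> f (x + s * h) < f x"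
    by auto
  define h where "h = min d e / 2"
  have "0 < h" "h < d" "h < e"
    using d(1) e(1) by (auto simp: h_def)
  with d(2)[of "x + s * h"] e(2)[of h] assms(1) show False
    by (simp add: abs_mult)
qed

text \<open>Rounding n/q down to \<open>n div q\<close> loses less than 1. The condition q
  \<epsilon> \<ge> pi makes the surplus q \<epsilon> / pi at least 1, so \<open>n div q\<close>
  still exceeds q/pi, the bound on the slope sum.\<close>

lemma strict_local_min_at_fraction:
  fixes \<epsilon> :: real
  assumes "q > 0" "coprime p (int q)" "real q * \<epsilon> \<ge> pi" "real n \<ge> (1 + \<epsilon>) * (real q)\<^sup>2 / pi"
  shows "strict_local_min_at (abs_sin_sum n) (of_int p / real q)"
proof (rule strict_local_min_atI)
  fix s :: real assume s: "\<bar>s\<bar> = 1"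
  define D where "D = (\<Sum>k=1..n. slope (real k * pi * (of_int p / real q)))"
  have "n < (n div q + 1) * q"
    using dividend_less_div_times[OF assms(1), of n] by simp
  then have "real n < (real (n div q) + 1) * real q"
    by (metis of_nat_1 of_nat_add of_nat_less_iff of_nat_mult)
  with assms(4) have "(1 + \<epsilon>) * (real q)\<^sup>2 / pi < (real (n div q) + 1) * real q"
    by linarith
  then have "((1 + \<epsilon>) * real q / pi) * real q < (real (n div q) + 1) * real q"
    by (simp add: power2_eq_square)
  then have "(1 + \<epsilon>) * real q / pi < real (n div q) + 1"
    using assms(1) by (simp only: mult_less_cancel_right_pos of_nat_0_less_iff)
  moreover have "(1 + \<epsilon>) * real q / pi = real q / pi + real q * \<epsilon> / pi"
    by (simp add: add_divide_distrib algebra_simps)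
  moreover have "real q * \<epsilon> / pi \<ge> 1"
    using assms(3) by simp
  ultimately have "real q / pi < real (n div q)"
    by linarith
  moreover have "\<bar>s * D\<bar> \<le> real q / pi"
    using abs_sum_slope_le[OF assms(2,1), of n] s by (simp add: D_def abs_mult)
  ultimately have "pi * (s * D + real (n div q)) > 0"
    by (intro mult_pos_pos) auto
  with abs_sin_sum_derivative_at_fraction[OF s assms(1,2), of n]
  show "\<exists>l>0. ((\<lambda>h. abs_sin_sum n (of_int p / real q + s * h)) has_real_derivative l) (at_right 0)"
    unfolding D_def by blast
qed

section \<open>Optimality of the constant\<close>

text \<open>The integral of cos over [0, pi/2] is 1. Comparison on the grid of width t = pi/q loses
  at most t at each end, so t times the sum is at least 1 - 2 t.\<close>

lemma sum_slope_half_period_ge: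
  assumes "q \<ge> 2"
  shows "(\<Sum>k=1..q div 2. slope (real k * pi * (1 / real q))) \<ge> real q / pi - 2"
proof -
  define t where "t = pi / real q"
  \<comment> \<open>The overshoot of the last grid point beyond pi/2, between 0 and t for either
    parity of \<open>q\<close>. Since cos \<ge> -1, the sine there is at least 1 - d.\<close>
  define d where "d = real (Suc (q div 2)) * t - pi / 2"
  have t: "t > 0" "real q * t = pi"
    using assms by (auto simp: t_def)
  have "q \<le> 2 * Suc (q div 2)" and "2 * Suc (q div 2) \<le> q + 2"
    by simp_all
  then have "real q * t \<le> real (2 * Suc (q div 2)) * t" "real (2 * Suc (q div 2)) * t \<le> real (q + 2) * t"
    using t by (meson mult_right_mono of_nat_mono less_imp_le)+
  with t have d: "0 \<le> d" "d \<le> t"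
    by (auto simp: d_def algebra_simps)
  have le: "real (Suc (q div 2)) * t \<le> real q * t"
    using t assms by (intro mult_right_mono) auto
  then have "(pi / 2 + d - pi / 2) * cos (pi / 2 + d) \<le> sin (pi / 2 + d) - sin (pi / 2)"
    using d t by (intro sin_diff_bounds) (auto simp: d_def)
  moreover have "d * cos (pi / 2 + d) \<ge> d * (-1)"
    using d by (intro mult_left_mono) auto
  ultimately have "sin (real (Suc (q div 2)) * t) \<ge> 1 - d"
    by (simp add: d_def)
  moreover have "sin t \<le> t"
    using t by (intro sin_x_le_x) simp
  ultimately have "1 - 2 * t \<le> t * (\<Sum>r=1..q div 2. cos (real r * t))"
    using sum_cos_ge[of t "q div 2"] le t d by linarith
  also have "(\<Sum>r=1..q div 2. cos (real r * t)) = (\<Sum>k=1..q div 2. slope (real k * pi * (1 / real q)))"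
  proof (rule sum.cong)
    fix k assume k: "k \<in> {1..q div 2}"
    then have "real k * t < real q * t"
      using t assms by (intro mult_strict_right_mono) auto
    with k t have "slope (real k * t) = cos (real k * t)"
      by (intro slope_eq_cos) auto
    then show "cos (real k * t) = slope (real k * pi * (1 / real q))"
      by (simp add: t_def)
  qed simp
  finally have "1 / t - 2 \<le> (\<Sum>k=1..q div 2. slope (real k * pi * (1 / real q)))"
    using t by (simp add: field_simps)
  then show ?thesis
    by (simp add: t_def)
qed

text \<open>The 3 pays for the loss of 2 in the half-period sum and for rounding c q up to an
  integer.\<close>

lemma exists_not_strict_local_min:
  fixes c :: real
  assumes "q \<ge> 2" "c > 0" "real q * (1 / pi - c) \<ge> 3"
  shows "\<exists>n. n > 0 \<and> real n \<ge> c * (real q)\<^sup>2 \<and> \<not> strict_local_min_at (abs_sin_sum n) (1 / real q)"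
proof -
  define a where "a = nat \<lceil>c * real q\<rceil>"
  \<comment> \<open>The \<open>a\<close> full periods give \<open>a\<close> kinks and no net slope,
    with \<open>a\<close> just large enough for n \<ge> c q^2. The extra half period collects the
    nonnegative cosines.\<close>
  define n where "n = q div 2 + a * q"
  have "n > 0"
    using assms by (simp add: n_def div_greater_zero_iff)
  have a: "c * real q \<le> real a" "real a < c * real q + 1"
    using assms by (simp_all add: a_def) linarith+
  have "c * real q * real q \<le> real a * real q"
    using a by (intro mult_right_mono) auto
  then have "real n \<ge> c * (real q)\<^sup>2"
    by (simp add: n_def power2_eq_square)
  have q: "q > 0" "coprime 1 (int q)"
    using assms by auto
  have n_div: "n div q = a" and n_mod: "n mod q = q div 2"
    using assms by (simp_all add: n_def)
  define D where "D = (\<Sum>k=1..n. slope (real k * pi * (1 / real q)))"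
  have "D = (\<Sum>k=1..q div 2. slope (real k * pi * (1 / real q)))"
    using sum_slope_mod[OF q(1), where n = n and p = 1] by (simp only: D_def n_mod of_int_1)
  also have "\<dots> \<ge> real q / pi - 2"
    by (rule sum_slope_half_period_ge) fact
  finally have "D > real a"
    using a assms(3) by (simp add: algebra_simps)
  \<comment> \<open>The slope sum is positive and outweighs the kinks, so the function decreases
    when moving left from 1/q.\<close>
  then have neg: "pi * (- 1 * D + real (n div q)) < 0"
    by (intro mult_pos_neg) (auto simp: n_div)
  have "\<not> strict_local_min_at (abs_sin_sum n) (1 / real q)"
    using abs_sin_sum_derivative_at_fraction[of "-1" q 1 n] q neg
    by (intro not_strict_local_min_atI[of "-1"]) (auto simp: D_def)
  with \<open>n > 0\<close> \<open>real n \<ge> c * (real q)\<^sup>2\<close> show ?thesis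
    by blast
qed

section \<open>Choice of the thresholds\<close>

theorem mainTheorem2:
  shows "(\<forall>\<epsilon>::real. \<epsilon> > 0 \<longrightarrow>
            (\<exists>q0::int. q0 > 0 \<and>
               (\<forall>q::int. \<forall>p::int. \<forall>n::nat.
                  q \<ge> q0 \<and> gcd p q = 1 \<and> n > 0 \<and> real n \<ge> (1 + \<epsilon>) * (real_of_int q)^2 / pi \<longrightarrow>
                    strict_local_min_at (abs_sin_sum n) (real_of_int p / real_of_int q))))
       \<and> (\<forall>c::real. 0 < c \<and> c < 1 / pi \<longrightarrow>
            (\<exists>q1::int. q1 > 0 \<and>
               (\<forall>q::int. q \<ge> q1 \<longrightarrow>
                  (\<exists>p::int. \<exists>n::nat. gcd p q = 1 \<and> n > 0 \<and> real n \<ge> c * (real_of_int q)^2 \<and>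
                    \<not> strict_local_min_at (abs_sin_sum n) (real_of_int p / real_of_int q)))))"
proof (intro conjI allI impI)
  fix \<epsilon> :: real assume \<epsilon>: "\<epsilon> > 0"
  \<comment> \<open>Chosen so that q \<ge> q0 gives q \<epsilon> \<ge> pi.\<close>
  define q0 where "q0 = \<lceil>pi / \<epsilon>\<rceil>"
  show "\<exists>q0::int. q0 > 0 \<and>
          (\<forall>q::int. \<forall>p::int. \<forall>n::nat.
             q \<ge> q0 \<and> gcd p q = 1 \<and> n > 0 \<and> real n \<ge> (1 + \<epsilon>) * (real_of_int q)^2 / pi \<longrightarrow>
               strict_local_min_at (abs_sin_sum n) (real_of_int p / real_of_int q))"
  proof (rule exI[of _ q0], intro conjI allI impI)
    show "q0 > 0"
      using \<epsilon> by (simp add: q0_def)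
    fix q p :: int and n :: nat
    assume *: "q \<ge> q0 \<and> gcd p q = 1 \<and> n > 0 \<and> real n \<ge> (1 + \<epsilon>) * (real_of_int q)^2 / pi"
    with \<open>q0 > 0\<close> obtain Q where Q: "q = int Q" "Q > 0"
      by (metis order_less_le_trans zero_less_imp_eq_int)
    from * have "pi / \<epsilon> \<le> real Q"
      unfolding q0_def Q by linarith
    then have "real Q * \<epsilon> \<ge> pi"
      using \<epsilon> by (simp add: field_simps)
    with * Q show "strict_local_min_at (abs_sin_sum n) (real_of_int p / real_of_int q)"
      using strict_local_min_at_fraction[of Q p \<epsilon> n] by (simp add: coprime_iff_gcd_eq_1)
  qed
next
  fix c :: real assume c: "0 < c \<and> c < 1 / pi"
  \<comment> \<open>Chosen so that q \<ge> q1 gives q (1/pi - c) \<ge> 3 as well as q \<ge> 2; the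
    denominator is positive because c < 1/pi.\<close>
  define q1 where "q1 = max 2 \<lceil>3 / (1 / pi - c)\<rceil>"
  show "\<exists>q1::int. q1 > 0 \<and>
          (\<forall>q::int. q \<ge> q1 \<longrightarrow>
             (\<exists>p::int. \<exists>n::nat. gcd p q = 1 \<and> n > 0 \<and> real n \<ge> c * (real_of_int q)^2 \<and>
               \<not> strict_local_min_at (abs_sin_sum n) (real_of_int p / real_of_int q)))"
  proof (rule exI[of _ q1], intro conjI allI impI)
    show "q1 > 0"
      by (simp add: q1_def)
    fix q :: int assume q: "q \<ge> q1"
    with \<open>q1 > 0\<close> obtain Q where Q: "q = int Q"
      by (metis order_less_le_trans zero_less_imp_eq_int)
    from q have "Q \<ge> 2" "3 / (1 / pi - c) \<le> real Q"
      unfolding q1_def Q by linarith+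
    moreover from this c have "real Q * (1 / pi - c) \<ge> 3"
      by (simp only: pos_divide_le_eq diff_gt_0_iff_gt)
    ultimately obtain n where
      "n > 0" "real n \<ge> c * (real Q)\<^sup>2" "\<not> strict_local_min_at (abs_sin_sum n) (1 / real Q)"
      using exists_not_strict_local_min[of Q c] c by blast
    then show "\<exists>p::int. \<exists>n::nat. gcd p q = 1 \<and> n > 0 \<and> real n \<ge> c * (real_of_int q)^2 \<and>
                 \<not> strict_local_min_at (abs_sin_sum n) (real_of_int p / real_of_int q)"
      unfolding Q by (intro exI[of _ 1] exI[of _ n]) simp
  qed
qed

end
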